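(* Let $\hat{\mathbf u}^n$, $n\ge 0$, be generated by the two-level Strang splitting method with time step $\tau$, $$\hat{\mathbf u}^{n+1}=\widehat{\mathcal M}_\tau\hat{\mathbf u}^n=\mathcal J^Q_{\tau/2}\,\widehat{\mathcal J}^P_\tau\,\mathcal J^Q_{\tau/2}\,\hat{\mathbf u}^n,\qquad \hat{\mathbf u}^0=\mathbf u^0 ,$$ and suppose that the initial vector satisfies $\|\mathbf u^0\|_\infty\le 1$. Then for every time step size $\tau>0$ the method preserves the discrete maximum principle, i.e. $$\|\hat{\mathbf u}^n\|_\infty\le 1\qquad\text{for all } n\ge 0 .$$
   Context: Let $d\in\{2,3\}$, $\varepsilon>0$, $a<b$, $\alpha_1,\dots,\alpha_d\in(1,2)$, integers $m_1,\dots,m_d\ge 2$, and $h_\ell=(b-a)/m_\ell$. $\|\cdot\|_\infty$ is the maximum norm of vectors. Coefficients: for $\alpha\in(1,2)$, $g_0^{(\alpha)}=1$, $g_{k+1}^{(\alpha)}=\big(1-\frac{\alpha+1}{k+1}\big)g_k^{(\alpha)}$ for $k\ge0$; $\omega_0^{(\alpha)}=\frac{\alpha}{2}g_0^{(\alpha)}$, $\omega_{k+1}^{(\alpha)}=\frac{\alpha}{2}g_{k+1}^{(\alpha)}+\frac{2-\alpha}{2}g_k^{(\alpha)}$ for $k\ge 0$. One-dimensional matrices: for $(\alpha,m,h)=(\alpha_\ell,m_\ell,h_\ell)$, let $D_\alpha\in\mathbb R^{(m-1)\times(m-1)}$ have entries $(D_\alpha)_{ij}=\omega^{(\alpha)}_{i-j+1}$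 if $i-j+1\ge 0$ and $0$ otherwise, and let $B_\alpha=-\frac{\varepsilon^2}{2h^\alpha\cos(\alpha\pi/2)}(D_\alpha+D_\alpha^\intercal)$, a symmetric Toeplitz matrix; write $(B_\alpha)_{ij}=b_{i-j}$. Then $B_\alpha=C_\alpha+S_\alpha$ with the circulant matrix $(C_\alpha)_{ij}=c_{i-j}$ and the skew-circulant matrix $(S_\alpha)_{ij}=s_{i-j}$, where $c_0=s_0=\frac12 b_0$; $c_k=\frac12(b_k+b_{k-m+1})$, $s_k=\frac12(b_k-b_{k-m+1})$ for $1\le k\le m-2$; $c_k=\frac12(b_k+b_{k+m-1})$, $s_k=\frac12(b_k-b_{k+m-1})$ for $2-m\le k\le -1$. Multi-dimensional matrices, with $I_{m_\ell}$ the identity of order $m_\ell-1$: for $d=2$, $C=I_{m_2}\otimes C_{\alpha_1}+C_{\alpha_2}\otimes I_{m_1}$ and $S=I_{m_2}\otimes S_{\alpha_1}+S_{\alpha_2}\otimes I_{m_1}$; for $d=3$, $C=I_{m_3}\otimes I_{m_2}\otimes C_{\alpha_1}+I_{m_3}\otimes C_{\alpha_2}\otimes I_{m_1}+C_{\alpha_3}\otimes I_{m_2}\otimes I_{m_1}$, and $S$ is defined in the same way with each $C_{\alpha_\ell}$ replaced by $S_{\alpha_\ell}$. All vectors lie in $\mathbb R^N$, $N=\prod_{\ell=1}^d(m_\ell-1)$. Operators, for $\tau\ge 0$ and $\mathbf v\in\mathbb R^N$: $\widehat{\mathcal J}^P_\tau\mathbf v=e^{\frac\tau2 C}e^{\tau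 S}e^{\frac\tau2 C}\mathbf v$, and, with all operations taken componentwise, $\mathcal J^Q_\tau\mathbf v=\dfrac{\mathbf v}{\sqrt{\mathbf v^2+(\mathbf 1-\mathbf v^2)e^{-2\tau}}}$, where $\mathbf 1$ is the all-ones vector. *)

theory Defs
  imports Complex_Main "Jordan_Normal_Form.Matrix"
begin

text \<open>Matrix indices start at 0. The Toeplitz-type matrices below depend on \<open>i - j\<close> only,
  so for them this changes nothing with respect to indices starting at 1.\<close>

subsection \<open>Coefficients\<close>

fun g_coeff :: "real \<Rightarrow> nat \<Rightarrow> real" where
  "g_coeff \<alpha> 0 = 1"
| "g_coeff \<alpha> (Suc k) = (1 - (\<alpha> + 1) / real (k + 1)) * g_coeff \<alpha> k"

fun \<omega>_coeff :: "real \<Rightarrow> nat \<Rightarrow> real" where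
  "\<omega>_coeff \<alpha> 0 = \<alpha> / 2 * g_coeff \<alpha> 0"
| "\<omega>_coeff \<alpha> (Suc k) = \<alpha> / 2 * g_coeff \<alpha> (Suc k) + (2 - \<alpha>) / 2 * g_coeff \<alpha> k"


subsection \<open>One-dimensional matrices, all of order \<open>m - 1\<close>\<close>

text \<open>The guard \<open>j \<le> i + 1\<close> is \<open>i - j + 1 \<ge> 0\<close>; under it the subtraction on
  natural numbers is exact.\<close>

definition D_mat :: "real \<Rightarrow> nat \<Rightarrow> real mat" where
  "D_mat \<alpha> m = mat (m - 1) (m - 1) (\<lambda>(i, j). if j \<le> i + 1 then \<omega>_coeff \<alpha> (i + 1 - j) else 0)"

definition B_mat :: "real \<Rightarrow> real \<Rightarrow> nat \<Rightarrow> real \<Rightarrow> real mat" where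
  "B_mat \<epsilon> \<alpha> m h =
     (- (\<epsilon>\<^sup>2 / (2 * h powr \<alpha> * cos (\<alpha> * pi / 2)))) \<cdot>\<^sub>m (D_mat \<alpha> m + transpose_mat (D_mat \<alpha> m))"

definition toeplitz :: "nat \<Rightarrow> (int \<Rightarrow> real) \<Rightarrow> real mat" where
  "toeplitz n f = mat n n (\<lambda>(i, j). f (int i - int j))"

text \<open>The generating sequence of a Toeplitz matrix, read off its first column and first row.\<close>

definition diag_entry :: "real mat \<Rightarrow> int \<Rightarrow> real" where
  "diag_entry A k = (if 0 \<le> k then A $$ (nat k, 0) else A $$ (0, nat (- k)))"

definition circ_coeff :: "nat \<Rightarrow> (int \<Rightarrow> real) \<Rightarrow> int \<Rightarrow> real" where
  "circ_coeff m b k =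
     (if k = 0 then b 0 / 2
      else if 0 < k then (b k + b (k - int m + 1)) / 2
      else (b k + b (k + int m - 1)) / 2)"

definition skew_coeff :: "nat \<Rightarrow> (int \<Rightarrow> real) \<Rightarrow> int \<Rightarrow> real" where
  "skew_coeff m b k =
     (if k = 0 then b 0 / 2
      else if 0 < k then (b k - b (k - int m + 1)) / 2
      else (b k - b (k + int m - 1)) / 2)"

definition C_mat :: "real \<Rightarrow> real \<Rightarrow> nat \<Rightarrow> real \<Rightarrow> real mat" where
  "C_mat \<epsilon> \<alpha> m h = toeplitz (m - 1) (circ_coeff m (diag_entry (B_mat \<epsilon> \<alpha> m h)))"

definition S_mat :: "real \<Rightarrow> real \<Rightarrow> nat \<Rightarrow> real \<Rightarrow> real mat" where
  "S_mat \<epsilon> \<alpha> m h = toeplitz (m - 1) (skew_coeff m (diag_entry (B_mat \<epsilon> \<alpha> m h)))"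

lemma B_mat_dim [simp]:
  "dim_row (B_mat \<epsilon> \<alpha> m h) = m - 1" "dim_col (B_mat \<epsilon> \<alpha> m h) = m - 1"
  by (simp_all add: B_mat_def D_mat_def)

lemma C_mat_dim [simp]:
  "dim_row (C_mat \<epsilon> \<alpha> m h) = m - 1" "dim_col (C_mat \<epsilon> \<alpha> m h) = m - 1"
  by (simp_all add: C_mat_def toeplitz_def)

lemma S_mat_dim [simp]:
  "dim_row (S_mat \<epsilon> \<alpha> m h) = m - 1" "dim_col (S_mat \<epsilon> \<alpha> m h) = m - 1"
  by (simp_all add: S_mat_def toeplitz_def)

lemma B_mat_toeplitz: "B_mat \<epsilon> \<alpha> m h = toeplitz (m - 1) (diag_entry (B_mat \<epsilon> \<alpha> m h))"
proof (rule eq_matI)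
  fix i j
  assume "i < dim_row (toeplitz (m - 1) (diag_entry (B_mat \<epsilon> \<alpha> m h)))"
    and "j < dim_col (toeplitz (m - 1) (diag_entry (B_mat \<epsilon> \<alpha> m h)))"
  then have ij: "i < m - 1" "j < m - 1" by (simp_all add: toeplitz_def)
  have *: "nat (int i - int j) = i - j" "nat (int j - int i) = j - i" by simp_all
  show "B_mat \<epsilon> \<alpha> m h $$ (i, j) = toeplitz (m - 1) (diag_entry (B_mat \<epsilon> \<alpha> m h)) $$ (i, j)"
  proof (cases "j \<le> i")
    case True
    then have "i + 1 - j = i - j + 1" "j + 1 - i = 1 - (i - j)" "i \<le> j + 1 \<longleftrightarrow> i - j \<le> 1"
      by linarith+
    then show ?thesis
      using ij True * by (simp add: toeplitz_def diag_entry_def B_mat_def D_mat_def)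
  next
    case False
    then have "i + 1 - j = 1 - (j - i)" "j + 1 - i = j - i + 1" "j \<le> i + 1 \<longleftrightarrow> j - i \<le> 1"
      by linarith+
    then show ?thesis
      using ij False * by (simp add: toeplitz_def diag_entry_def B_mat_def D_mat_def)
  qed
qed (simp_all add: toeplitz_def)

lemma B_mat_splitting: "B_mat \<epsilon> \<alpha> m h = C_mat \<epsilon> \<alpha> m h + S_mat \<epsilon> \<alpha> m h"
  by (subst B_mat_toeplitz)
    (auto intro!: eq_matI
      simp: C_mat_def S_mat_def toeplitz_def circ_coeff_def skew_coeff_def field_simps)


subsection \<open>Multi-dimensional matrices\<close>

definition kron :: "real mat \<Rightarrow> real mat \<Rightarrow> real mat" (infixr "\<otimes>\<^sub>K" 72) where
  "A \<otimes>\<^sub>K B = mat (dim_row A * dim_row B) (dim_col A * dim_col B)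
     (\<lambda>(i, j). A $$ (i div dim_row B, j div dim_col B) * B $$ (i mod dim_row B, j mod dim_col B))"

text \<open>\<open>A l\<close> is a matrix of order \<open>m l - 1\<close> for \<open>l = 1, \<dots>, d\<close>; only \<open>d = 2\<close> and \<open>d = 3\<close>
  are meaningful.\<close>

definition kron_sum :: "nat \<Rightarrow> (nat \<Rightarrow> nat) \<Rightarrow> (nat \<Rightarrow> real mat) \<Rightarrow> real mat" where
  "kron_sum d m A =
     (let I = (\<lambda>l. 1\<^sub>m (m l - 1)) in
      if d = 2 then I 2 \<otimes>\<^sub>K A 1 + A 2 \<otimes>\<^sub>K I 1
      else I 3 \<otimes>\<^sub>K I 2 \<otimes>\<^sub>K A 1 + I 3 \<otimes>\<^sub>K A 2 \<otimes>\<^sub>K I 1 + A 3 \<otimes>\<^sub>K I 2 \<otimes>\<^sub>K I 1)"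

definition C_full :: "nat \<Rightarrow> real \<Rightarrow> (nat \<Rightarrow> real) \<Rightarrow> (nat \<Rightarrow> nat) \<Rightarrow> (nat \<Rightarrow> real) \<Rightarrow> real mat" where
  "C_full d \<epsilon> \<alpha> m h = kron_sum d m (\<lambda>l. C_mat \<epsilon> (\<alpha> l) (m l) (h l))"

definition S_full :: "nat \<Rightarrow> real \<Rightarrow> (nat \<Rightarrow> real) \<Rightarrow> (nat \<Rightarrow> nat) \<Rightarrow> (nat \<Rightarrow> real) \<Rightarrow> real mat" where
  "S_full d \<epsilon> \<alpha> m h = kron_sum d m (\<lambda>l. S_mat \<epsilon> (\<alpha> l) (m l) (h l))"

lemma kron_sum_carrier:
  assumes "d \<in> {2, 3}" and "\<And>l. l \<in> {1..d} \<Longrightarrow> A l \<in> carrier_mat (m l - 1) (m l - 1)"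
  shows "kron_sum d m A \<in> carrier_mat (\<Prod>l=1..d. (m l - 1)) (\<Prod>l=1..d. (m l - 1))"
proof -
  have dims: "A l \<in> carrier_mat (m l - 1) (m l - 1)" if "1 \<le> l" "l \<le> d" for l
    using assms(2) that by simp
  have N: "(\<Prod>l=1..2. m l - 1) = (m 1 - 1) * (m 2 - 1)"
    "(\<Prod>l=1..3. m l - 1) = (m 1 - 1) * (m 2 - 1) * (m 3 - 1)"
    by (simp_all add: eval_nat_numeral)
  consider "d = 2" | "d = 3" using assms(1) by blast
  then show ?thesis
  proof cases
    case 1
    then show ?thesis using dims[of 1] dims[of 2] N
      by (auto simp: kron_sum_def kron_def Let_def mult_ac)
  next
    case 2
    then show ?thesis using dims[of 1] dims[of 2] dims[of 3] N
      by (auto simp: kron_sum_def kron_def Let_def mult_ac)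
  qed
qed


subsection \<open>Matrix exponential and maximum norm\<close>

text \<open>The power series is summed entry by entry, which is convergence in the
  finite-dimensional space of square matrices. It always converges, see
  \<open>mat_exp_summable\<close>.\<close>

definition mat_exp :: "real mat \<Rightarrow> real mat" where
  "mat_exp A = mat (dim_row A) (dim_row A) (\<lambda>(i, j). \<Sum>k. (A ^\<^sub>m k) $$ (i, j) / fact k)"

lemma pow_mat_entry_bound:
  fixes A :: "real mat"
  assumes A: "A \<in> carrier_mat n n" and M: "\<And>i j. i < n \<Longrightarrow> j < n \<Longrightarrow> \<bar>A $$ (i, j)\<bar> \<le> M"
    and "i < n" "j < n"
  shows "\<bar>(A ^\<^sub>m k) $$ (i, j)\<bar> \<le> (real n * M) ^ k"
  using \<open>i < n\<close> \<open>j < n\<close>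
proof (induction k arbitrary: i j)
  case 0
  then show ?case using A by simp
next
  case (Suc k)
  have P: "A ^\<^sub>m k \<in> carrier_mat n n" using A by simp
  have "(A ^\<^sub>m Suc k) $$ (i, j) = (\<Sum>l<n. (A ^\<^sub>m k) $$ (i, l) * A $$ (l, j))"
    using Suc.prems A P by (auto simp: scalar_prod_def atLeast0LessThan intro!: sum.cong)
  also have "\<bar>\<dots>\<bar> \<le> (\<Sum>l<n. (real n * M) ^ k * M)"
  proof (rule sum_abs[THEN order_trans], rule sum_mono)
    fix l assume "l \<in> {..<n}"
    then have l: "l < n" by simp
    show "\<bar>(A ^\<^sub>m k) $$ (i, l) * A $$ (l, j)\<bar> \<le> (real n * M) ^ k * M"
      unfolding abs_mult
      by (rule mult_mono'[OF Suc.IH[OF Suc.prems(1) l] M[OF l Suc.prems(2)]]) simp_all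
  qed
  also have "\<dots> = (real n * M) ^ Suc k" by simp
  finally show ?case .
qed

lemma mat_exp_summable:
  fixes A :: "real mat"
  assumes A: "A \<in> carrier_mat n n" and ij: "i < n" "j < n"
  shows "summable (\<lambda>k. (A ^\<^sub>m k) $$ (i, j) / fact k)"
proof -
  define M where "M = (\<Sum>i<n. \<Sum>j<n. \<bar>A $$ (i, j)\<bar>)"
  have M: "\<bar>A $$ (i, j)\<bar> \<le> M" if "i < n" "j < n" for i j
  proof -
    have "\<bar>A $$ (i, j)\<bar> \<le> (\<Sum>j<n. \<bar>A $$ (i, j)\<bar>)"
      using that by (intro member_le_sum) auto
    also have "\<dots> \<le> M"
      unfolding M_def using that
      by (intro member_le_sum[of i "{..<n}" "\<lambda>i. \<Sum>j<n. \<bar>A $$ (i, j)\<bar>"]) (auto intro: sum_nonneg)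
    finally show ?thesis .
  qed
  have "summable (\<lambda>k. (real n * M) ^ k / fact k)"
    using summable_exp[of "real n * M"] by (simp add: field_simps)
  moreover have "norm ((A ^\<^sub>m k) $$ (i, j) / fact k) \<le> (real n * M) ^ k / fact k" for k
    using divide_right_mono[OF pow_mat_entry_bound[OF A M ij, of k], of "fact k"] by simp
  ultimately show ?thesis
    by (rule summable_comparison_test'[where N = 0])
qed

text \<open>Only used in dimension at least 1; for the empty vector the maximum is unspecified.\<close>

definition max_norm :: "real vec \<Rightarrow> real" where
  "max_norm v = Max ((\<lambda>i. \<bar>v $ i\<bar>) ` {..<dim_vec v})"


subsection \<open>Operators\<close>

definition J_P :: "real mat \<Rightarrow> real mat \<Rightarrow> real \<Rightarrow> real vec \<Rightarrow> real vec" where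
  "J_P C S \<tau> v =
     (mat_exp ((\<tau> / 2) \<cdot>\<^sub>m C) * mat_exp (\<tau> \<cdot>\<^sub>m S) * mat_exp ((\<tau> / 2) \<cdot>\<^sub>m C)) *\<^sub>v v"

definition J_Q :: "real \<Rightarrow> real vec \<Rightarrow> real vec" where
  "J_Q \<tau> v = map_vec (\<lambda>x. x / sqrt (x\<^sup>2 + (1 - x\<^sup>2) * exp (- 2 * \<tau>))) v"

definition strang_step :: "real mat \<Rightarrow> real mat \<Rightarrow> real \<Rightarrow> real vec \<Rightarrow> real vec" where
  "strang_step C S \<tau> v = J_Q (\<tau> / 2) (J_P C S \<tau> (J_Q (\<tau> / 2) v))"

end

theory Submission
  imports Defs
begin

text \<open>
  Each of the three factors of a Strang step maps the unit ball of the maximum norm into itself.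
  For \<open>J_Q\<close> this is an elementary inequality for each component. For the linear part it says that
  \<open>e\<^bsup>tC\<^esup>\<close> and \<open>e\<^bsup>tS\<^esup>\<close> are contractions in the maximum norm, whose operator norm is the largest
  absolute row sum.

  Such a contraction comes from weak diagonal dominance with a nonpositive diagonal. If
  \<open>A\<^sub>i\<^sub>i + (\<Sum>j\<noteq>i. \<bar>A\<^sub>i\<^sub>j\<bar>) \<le> 0\<close> in every row, then the matrix \<open>A + L I\<close> has norm at most
  \<open>L\<close> once \<open>L\<close> is large, so that
  \<open>\<parallel>e\<^bsup>A\<^esup>\<parallel> = e\<^bsup>-L\<^esup> \<parallel>e\<^bsup>A + L I\<^esup>\<parallel> \<le> e\<^bsup>-L\<^esup> e\<^bsup>L\<^esup> = 1\<close>
  (\<open>dissipative_diag_dominant\<close>, \<open>row_bound_mat_exp\<close>). The existence of such an \<open>L\<close>, called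
  \<open>dissipative\<close> below, is stable under sums and under Kronecker products with identities, because
  \<open>I \<otimes> A + L I = I \<otimes> (A + L I)\<close>. This reduces two and three space dimensions to one.

  In one dimension, splitting a Toeplitz matrix with entries \<open>b\<^sub>k\<close> into its circulant and
  skew-circulant parts halves the diagonal, while the off-diagonal absolute row sum of either part
  is at most \<open>\<Sum>0<k<m-1. b\<^sub>k\<close> when these \<open>b\<^sub>k\<close> are nonnegative
  (\<open>dissipative_toeplitz_wrap\<close>). Diagonal dominance thus amounts to
  \<open>b\<^sub>0 / 2 + (\<Sum>0<k<m-1. b\<^sub>k) \<le> 0\<close>. Since each \<open>b\<^sub>k\<close> is a nonnegative multiple of
  entries of \<open>D + D\<^sup>T\<close>, the left-hand side is the same multiple of the partial sum
  \<open>\<omega>\<^sub>0 + \<dots> + \<omega>\<^bsub>m-1\<^esub>\<close> if \<open>m \<ge> 3\<close>. As \<open>\<omega>\<^sub>k\<close> is a positive combination of \<open>g\<^sub>k\<close> and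
  \<open>g\<^bsub>k-1\<^esub>\<close>, so are its partial sums of those of \<open>g\<close>. They are nonpositive because the partial sums of
  \<open>g\<^sup>(\<^sup>\<alpha>\<^sup>)\<close>, the Taylor coefficients of \<open>(1 - z)\<^sup>\<alpha>\<close>, are the Taylor coefficients of
  \<open>(1 - z)\<^bsup>\<alpha>-1\<^esup>\<close>, and these are nonpositive from index 1 on when \<open>0 < \<alpha> - 1 < 1\<close>.
\<close>

section \<open>Absolute row sums\<close>

definition row_bound :: "real mat \<Rightarrow> real \<Rightarrow> bool" where
  "row_bound A x \<longleftrightarrow> (\<forall>i<dim_row A. (\<Sum>j<dim_col A. \<bar>A $$ (i, j)\<bar>) \<le> x)"

lemma row_bound_add:
  assumes "row_bound A x" "row_bound B y" "A \<in> carrier_mat n k" "B \<in> carrier_mat n k"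
  shows "row_bound (A + B) (x + y)"
  unfolding row_bound_def
proof (intro allI impI)
  fix i assume "i < dim_row (A + B)"
  then have i: "i < n" using assms by simp
  have "(\<Sum>j<dim_col (A + B). \<bar>(A + B) $$ (i, j)\<bar>) = (\<Sum>j<k. \<bar>A $$ (i, j) + B $$ (i, j)\<bar>)"
    using assms i by (intro sum.cong) auto
  also have "\<dots> \<le> (\<Sum>j<k. \<bar>A $$ (i, j)\<bar>) + (\<Sum>j<k. \<bar>B $$ (i, j)\<bar>)"
    unfolding sum.distrib[symmetric] by (intro sum_mono abs_triangle_ineq)
  also have "\<dots> \<le> x + y" using assms i by (intro add_mono) (auto simp: row_bound_def)
  finally show "(\<Sum>j<dim_col (A + B). \<bar>(A + B) $$ (i, j)\<bar>) \<le> x + y" .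
qed

lemma row_bound_smult:
  assumes "row_bound A x" "c \<ge> 0"
  shows "row_bound (c \<cdot>\<^sub>m A) (c * x)"
  using assms
  by (auto simp: row_bound_def abs_mult sum_distrib_left[symmetric] intro!: mult_left_mono)

lemma row_bound_mult:
  assumes "row_bound A x" "row_bound B y" "A \<in> carrier_mat n k" "B \<in> carrier_mat k r" "0 \<le> y"
  shows "row_bound (A * B) (x * y)"
  unfolding row_bound_def
proof (intro allI impI)
  fix i assume "i < dim_row (A * B)"
  then have i: "i < n" using assms by simp
  have "(\<Sum>j<dim_col (A * B). \<bar>(A * B) $$ (i, j)\<bar>)
      = (\<Sum>j<r. \<bar>\<Sum>l<k. A $$ (i, l) * B $$ (l, j)\<bar>)"
    using assms i by (intro sum.cong) (auto simp: scalar_prod_def atLeast0LessThan)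
  also have "\<dots> \<le> (\<Sum>j<r. \<Sum>l<k. \<bar>A $$ (i, l)\<bar> * \<bar>B $$ (l, j)\<bar>)"
    unfolding abs_mult[symmetric] by (intro sum_mono sum_abs)
  also have "\<dots> = (\<Sum>l<k. \<bar>A $$ (i, l)\<bar> * (\<Sum>j<r. \<bar>B $$ (l, j)\<bar>))"
    unfolding sum_distrib_left by (rule sum.swap)
  also have "\<dots> \<le> (\<Sum>l<k. \<bar>A $$ (i, l)\<bar> * y)"
    using assms by (intro sum_mono mult_left_mono) (auto simp: row_bound_def)
  also have "\<dots> \<le> x * y"
    using assms i unfolding sum_distrib_right[symmetric]
    by (intro mult_right_mono) (auto simp: row_bound_def)
  finally show "(\<Sum>j<dim_col (A * B). \<bar>(A * B) $$ (i, j)\<bar>) \<le> x * y" .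
qed

lemma row_bound_one: "row_bound (1\<^sub>m n) 1"
proof -
  have "(\<Sum>j<n. \<bar>(1\<^sub>m n :: real mat) $$ (i, j)\<bar>) = 1" if i: "i < n" for i
  proof -
    have "(\<Sum>j<n. \<bar>(1\<^sub>m n :: real mat) $$ (i, j)\<bar>) = (\<Sum>j<n. if j = i then 1 else 0)"
      using i by (intro sum.cong) auto
    then show ?thesis using i by simp
  qed
  then show ?thesis by (simp add: row_bound_def)
qed

lemma row_bound_pow:
  assumes "row_bound A x" "A \<in> carrier_mat n n" "0 \<le> x"
  shows "row_bound (A ^\<^sub>m k) (x ^ k)"
proof (induction k)
  case 0
  then show ?case using assms row_bound_one by simp
next
  case (Suc k)
  then show ?case
    using row_bound_mult[OF Suc assms(1) _ assms(2) assms(3), of n] assms(2)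
    by (simp add: mult.commute)
qed

lemma row_bound_mult_vec:
  assumes "row_bound A x" "A \<in> carrier_mat n k" "v \<in> carrier_vec k"
    and "\<And>j. j < k \<Longrightarrow> \<bar>v $ j\<bar> \<le> 1" "i < n"
  shows "\<bar>(A *\<^sub>v v) $ i\<bar> \<le> x"
proof -
  have "\<bar>(A *\<^sub>v v) $ i\<bar> = \<bar>\<Sum>l<k. A $$ (i, l) * v $ l\<bar>"
    using assms by (auto simp: scalar_prod_def atLeast0LessThan)
  also have "\<dots> \<le> (\<Sum>l<k. \<bar>A $$ (i, l)\<bar> * \<bar>v $ l\<bar>)"
    unfolding abs_mult[symmetric] by (rule sum_abs)
  also have "\<dots> \<le> (\<Sum>l<k. \<bar>A $$ (i, l)\<bar> * 1)"
    using assms by (intro sum_mono mult_left_mono) auto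
  also have "\<dots> \<le> x" using assms by (auto simp: row_bound_def)
  finally show ?thesis .
qed

text \<open>Splitting a row index of a Kronecker product by division and remainder turns its absolute row
  sum into a product of two.\<close>

lemma sum_div_mod:
  fixes f g :: "nat \<Rightarrow> real"
  shows "(\<Sum>j<a * b. f (j div b) * g (j mod b)) = (\<Sum>p<a. f p) * (\<Sum>q<b. g q)"
proof -
  have "(\<Sum>j<a * b. f (j div b) * g (j mod b))
      = (\<Sum>p<a. \<Sum>j\<in>{p * b..<p * b + b}. f (j div b) * g (j mod b))"
    by (rule sum.nat_group[symmetric])
  also have "\<dots> = (\<Sum>p<a. \<Sum>q<b. f p * g q)"
  proof (rule sum.cong[OF refl])
    fix p
    have "(\<Sum>j\<in>{p * b..<p * b + b}. f (j div b) * g (j mod b))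
        = (\<Sum>q\<in>{0..<b}. f ((q + p * b) div b) * g ((q + p * b) mod b))"
      using sum.shift_bounds_nat_ivl[of "\<lambda>j. f (j div b) * g (j mod b)" 0 "p * b" b]
      by (simp add: add.commute)
    also have "\<dots> = (\<Sum>q<b. f p * g q)"
      unfolding atLeast0LessThan by (intro sum.cong) auto
    finally show "(\<Sum>j\<in>{p * b..<p * b + b}. f (j div b) * g (j mod b)) = (\<Sum>q<b. f p * g q)" .
  qed
  finally show ?thesis by (simp add: sum_product)
qed

lemma row_bound_kron:
  assumes "row_bound A x" "row_bound B y" "0 \<le> y"
  shows "row_bound (A \<otimes>\<^sub>K B) (x * y)"
  unfolding row_bound_def
proof (intro allI impI)
  fix i assume "i < dim_row (A \<otimes>\<^sub>K B)"
  then have i: "i < dim_row A * dim_row B" by (simp add: kron_def)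
  then have B0: "0 < dim_row B" by (cases "dim_row B") auto
  have i1: "i div dim_row B < dim_row A" using i by (simp add: less_mult_imp_div_less)
  have i2: "i mod dim_row B < dim_row B" using B0 by simp
  have "(\<Sum>j<dim_col (A \<otimes>\<^sub>K B). \<bar>(A \<otimes>\<^sub>K B) $$ (i, j)\<bar>)
     = (\<Sum>j<dim_col A * dim_col B. \<bar>A $$ (i div dim_row B, j div dim_col B)\<bar>
          * \<bar>B $$ (i mod dim_row B, j mod dim_col B)\<bar>)"
    using i by (auto simp: kron_def abs_mult intro!: sum.cong)
  also have "\<dots> = (\<Sum>p<dim_col A. \<bar>A $$ (i div dim_row B, p)\<bar>)
      * (\<Sum>q<dim_col B. \<bar>B $$ (i mod dim_row B, q)\<bar>)"
    by (rule sum_div_mod)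
  also have "\<dots> \<le> x * y"
  proof (rule mult_mono')
    show "(\<Sum>p<dim_col A. \<bar>A $$ (i div dim_row B, p)\<bar>) \<le> x"
      using assms(1) i1 by (simp add: row_bound_def)
    show "(\<Sum>q<dim_col B. \<bar>B $$ (i mod dim_row B, q)\<bar>) \<le> y"
      using assms(2) i2 by (simp add: row_bound_def)
  qed (auto intro: sum_nonneg)
  finally show "(\<Sum>j<dim_col (A \<otimes>\<^sub>K B). \<bar>(A \<otimes>\<^sub>K B) $$ (i, j)\<bar>) \<le> x * y" .
qed

section \<open>Dissipative matrices\<close>

lemma kron_carrier:
  "A \<in> carrier_mat p q \<Longrightarrow> B \<in> carrier_mat r s \<Longrightarrow> A \<otimes>\<^sub>K B \<in> carrier_mat (p * r) (q * s)"
  by (simp add: kron_def)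

lemma div_mod_less:
  fixes i :: nat assumes "i < p * r" shows "i div r < p" "i mod r < r"
proof -
  have "0 < r" using assms by (cases r) auto
  then show "i mod r < r" by simp
  show "i div r < p" using assms by (simp add: less_mult_imp_div_less)
qed

lemma div_mod_eq_iff: "i div r = j div r \<and> i mod r = j mod r \<longleftrightarrow> i = (j :: nat)"
  by (metis div_mult_mod_eq)

text \<open>Kronecker products with an identity commute with shifts by a multiple of the identity, so that
  a shift which works for \<open>A\<close> works for the product with the same constant.\<close>

lemma kron_one_shift_left:
  assumes "A \<in> carrier_mat r r"
  shows "1\<^sub>m p \<otimes>\<^sub>K (A + L \<cdot>\<^sub>m 1\<^sub>m r) = 1\<^sub>m p \<otimes>\<^sub>K A + L \<cdot>\<^sub>m 1\<^sub>m (p * r)"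
  using assms div_mod_eq_iff[of _ r]
  by (intro eq_matI) (auto simp: kron_def div_mod_less)

lemma kron_one_shift_right:
  assumes "A \<in> carrier_mat p p"
  shows "(A + L \<cdot>\<^sub>m 1\<^sub>m p) \<otimes>\<^sub>K 1\<^sub>m r = A \<otimes>\<^sub>K 1\<^sub>m r + L \<cdot>\<^sub>m 1\<^sub>m (p * r)"
  using assms div_mod_eq_iff[of _ r]
  by (intro eq_matI) (auto simp: kron_def div_mod_less)

text \<open>The infinitesimal form of a contraction semigroup. For large \<open>L\<close> the shifted matrix has a
  nonnegative diagonal, and the bound then says that the logarithmic maximum norm
  \<open>max\<^sub>i (A\<^sub>i\<^sub>i + (\<Sum>j\<noteq>i. \<bar>A\<^sub>i\<^sub>j\<bar>))\<close> is nonpositive. In terms of a shift, stability under sums and Kronecker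
  products follows from submultiplicativity alone, without inspecting the diagonal.\<close>

definition dissipative :: "real mat \<Rightarrow> bool" where
  "dissipative A \<longleftrightarrow> (\<exists>L\<ge>0. row_bound (A + L \<cdot>\<^sub>m 1\<^sub>m (dim_row A)) L)"

lemma dissipative_add:
  assumes "dissipative A" "dissipative B" "A \<in> carrier_mat n n" "B \<in> carrier_mat n n"
  shows "dissipative (A + B)"
proof -
  obtain L M where L: "L \<ge> 0" "row_bound (A + L \<cdot>\<^sub>m 1\<^sub>m n) L"
    and M: "M \<ge> 0" "row_bound (B + M \<cdot>\<^sub>m 1\<^sub>m n) M"
    using assms unfolding dissipative_def by auto
  have "A + B + (L + M) \<cdot>\<^sub>m 1\<^sub>m n = (A + L \<cdot>\<^sub>m 1\<^sub>m n) + (B + M \<cdot>\<^sub>m 1\<^sub>m n)"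
    using assms by (intro eq_matI) (auto simp: algebra_simps)
  moreover have "row_bound ((A + L \<cdot>\<^sub>m 1\<^sub>m n) + (B + M \<cdot>\<^sub>m 1\<^sub>m n)) (L + M)"
    using L M assms by (intro row_bound_add[where n = n and k = n]) auto
  ultimately show ?thesis
    using L M assms unfolding dissipative_def by (intro exI[of _ "L + M"]) auto
qed

lemma dissipative_smult:
  assumes "dissipative A" "A \<in> carrier_mat n n" "c \<ge> 0"
  shows "dissipative (c \<cdot>\<^sub>m A)"
proof -
  obtain L where L: "L \<ge> 0" "row_bound (A + L \<cdot>\<^sub>m 1\<^sub>m n) L"
    using assms unfolding dissipative_def by auto
  have "c \<cdot>\<^sub>m A + (c * L) \<cdot>\<^sub>m 1\<^sub>m n = c \<cdot>\<^sub>m (A + L \<cdot>\<^sub>m 1\<^sub>m n)"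
    using assms by (intro eq_matI) (auto simp: algebra_simps)
  then show ?thesis
    using row_bound_smult[OF L(2) assms(3)] L assms unfolding dissipative_def
    by (intro exI[of _ "c * L"]) auto
qed

lemma dissipative_kron_one_left:
  assumes "dissipative A" "A \<in> carrier_mat r r"
  shows "dissipative (1\<^sub>m p \<otimes>\<^sub>K A)"
proof -
  obtain L where L: "L \<ge> 0" "row_bound (A + L \<cdot>\<^sub>m 1\<^sub>m r) L"
    using assms unfolding dissipative_def by auto
  have "row_bound (1\<^sub>m p \<otimes>\<^sub>K A + L \<cdot>\<^sub>m 1\<^sub>m (p * r)) L"
    using row_bound_kron[OF row_bound_one[of p] L(2) L(1)]
    by (simp add: kron_one_shift_left[OF assms(2)])
  then show ?thesis
    using L assms kron_carrier[OF one_carrier_mat assms(2), of p] unfolding dissipative_def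
    by (intro exI[of _ L]) auto
qed

lemma dissipative_kron_one_right:
  assumes "dissipative A" "A \<in> carrier_mat p p"
  shows "dissipative (A \<otimes>\<^sub>K 1\<^sub>m r)"
proof -
  obtain L where L: "L \<ge> 0" "row_bound (A + L \<cdot>\<^sub>m 1\<^sub>m p) L"
    using assms unfolding dissipative_def by auto
  have "row_bound (A \<otimes>\<^sub>K 1\<^sub>m r + L \<cdot>\<^sub>m 1\<^sub>m (p * r)) L"
    using row_bound_kron[OF L(2) row_bound_one[of r]]
    by (simp add: kron_one_shift_right[OF assms(2)])
  then show ?thesis
    using L assms kron_carrier[OF assms(2) one_carrier_mat, of r] unfolding dissipative_def
    by (intro exI[of _ L]) auto
qed

lemma dissipative_kron_sum:
  assumes "d \<in> {2, 3}"
    and "\<And>l. l \<in> {1..d} \<Longrightarrow> A l \<in> carrier_mat (m l - 1) (m l - 1)"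
    and "\<And>l. l \<in> {1..d} \<Longrightarrow> dissipative (A l)"
  shows "dissipative (kron_sum d m A)"
proof -
  define n where "n l = m l - 1" for l
  have A: "A l \<in> carrier_mat (n l) (n l)" "dissipative (A l)" if "1 \<le> l" "l \<le> d" for l
    using assms(2)[of l] assms(3)[of l] that by (auto simp: n_def)
  note carr = kron_carrier one_carrier_mat
  consider "d = 2" | "d = 3" using assms(1) by blast
  then show ?thesis
  proof cases
    case 1
    have "dissipative (1\<^sub>m (n 2) \<otimes>\<^sub>K A 1 + A 2 \<otimes>\<^sub>K 1\<^sub>m (n 1))"
      using A[of 1] A[of 2] 1
      by (intro dissipative_add[where n = "n 2 * n 1"] dissipative_kron_one_left[where r = "n 1"]
          dissipative_kron_one_right[where p = "n 2"] carr) auto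
    then show ?thesis using 1 by (simp add: kron_sum_def n_def)
  next
    case 2
    have one: "1\<^sub>m p \<otimes>\<^sub>K 1\<^sub>m q = 1\<^sub>m (p * q)" for p q
      using div_mod_eq_iff[of _ q] by (intro eq_matI) (auto simp: kron_def div_mod_less)
    have I: "dissipative (1\<^sub>m (n 3) \<otimes>\<^sub>K 1\<^sub>m (n 2) \<otimes>\<^sub>K A 1)"
      using A[of 1] 2
      by (intro dissipative_kron_one_left[where r = "n 2 * n 1"]
          dissipative_kron_one_left[where r = "n 1"] carr) auto
    have II: "dissipative (1\<^sub>m (n 3) \<otimes>\<^sub>K A 2 \<otimes>\<^sub>K 1\<^sub>m (n 1))"
      using A[of 2] 2
      by (intro dissipative_kron_one_left[where r = "n 2 * n 1"]
          dissipative_kron_one_right[where p = "n 2"] carr) auto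
    have III: "dissipative (A 3 \<otimes>\<^sub>K 1\<^sub>m (n 2) \<otimes>\<^sub>K 1\<^sub>m (n 1))"
      using A[of 3] 2 unfolding one
      by (intro dissipative_kron_one_right[where p = "n 3"]) auto
    have "dissipative (1\<^sub>m (n 3) \<otimes>\<^sub>K 1\<^sub>m (n 2) \<otimes>\<^sub>K A 1 + 1\<^sub>m (n 3) \<otimes>\<^sub>K A 2 \<otimes>\<^sub>K 1\<^sub>m (n 1)
        + A 3 \<otimes>\<^sub>K 1\<^sub>m (n 2) \<otimes>\<^sub>K 1\<^sub>m (n 1))"
      using A[of 1] A[of 2] A[of 3] 2
      by (intro dissipative_add[where n = "n 3 * (n 2 * n 1)"] I II III carr add_carrier_mat) auto
    then show ?thesis using 2 by (simp add: kron_sum_def n_def)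
  qed
qed

section \<open>The exponential of a dissipative matrix\<close>

text \<open>The binomial theorem for the commuting matrices \<open>P\<close> and \<open>- L I\<close>, divided by \<open>k!\<close>. In this
  form it is a Cauchy product, and the induction step is the Leibniz rule: multiplying the \<open>k\<close>-th
  term by \<open>P - L I\<close> raises the degree in one of the two factors.\<close>

lemma pow_mat_shift:
  fixes A :: "real mat" and L :: real
  assumes A: "A \<in> carrier_mat n n" and ij: "i < n" "j < n"
  defines "P \<equiv> A + L \<cdot>\<^sub>m 1\<^sub>m n"
  shows "(A ^\<^sub>m k) $$ (i, j) / fact k
       = (\<Sum>r\<le>k. ((P ^\<^sub>m r) $$ (i, j) / fact r) * ((- L) ^ (k - r) / fact (k - r)))"
  using ij(2)
proof (induction k arbitrary: j)
  case 0
  then show ?case using A ij by (simp add: P_def)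
next
  case (Suc k)
  have P: "P \<in> carrier_mat n n" using A by (simp add: P_def)
  define p where "p r j = (P ^\<^sub>m r) $$ (i, j) / fact r" for r j
  define l where "l s = (- L) ^ s / fact s" for s :: nat
  have PS: "(\<Sum>q<n. p r q * P $$ (q, j)) = real (Suc r) * p (Suc r) j" for r
  proof -
    have "(P ^\<^sub>m Suc r) $$ (i, j) = (\<Sum>q<n. (P ^\<^sub>m r) $$ (i, q) * P $$ (q, j))"
      using Suc.prems ij P pow_carrier_mat[OF P, of r]
      by (auto simp: scalar_prod_def atLeast0LessThan intro!: sum.cong)
    then show ?thesis
      by (simp add: p_def sum_divide_distrib[symmetric] field_simps del: pow_mat.simps of_nat_Suc)
  qed
  have lS: "- L * l s = real (Suc s) * l (Suc s)" for s
    by (simp add: l_def field_simps del: of_nat_Suc)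
  have IH: "(A ^\<^sub>m k) $$ (i, q) / fact k = (\<Sum>r\<le>k. p r q * l (k - r))" if "q < n" for q
    using Suc.IH[OF that] by (simp add: p_def l_def)
  have "(A ^\<^sub>m Suc k) $$ (i, j) = (\<Sum>q<n. (A ^\<^sub>m k) $$ (i, q) * A $$ (q, j))"
    using Suc.prems ij A pow_carrier_mat[OF A, of k]
    by (auto simp: scalar_prod_def atLeast0LessThan intro!: sum.cong)
  then have "(A ^\<^sub>m Suc k) $$ (i, j) / fact k = (\<Sum>q<n. (A ^\<^sub>m k) $$ (i, q) / fact k * A $$ (q, j))"
    by (simp add: sum_divide_distrib del: pow_mat.simps)
  also have "\<dots> = (\<Sum>q<n. (\<Sum>r\<le>k. p r q * l (k - r)) * (P $$ (q, j) - (if q = j then L else 0)))"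
    using A Suc.prems by (intro sum.cong) (auto simp: IH P_def)
  also have "\<dots> = (\<Sum>q<n. (\<Sum>r\<le>k. p r q * l (k - r)) * P $$ (q, j))
       - (\<Sum>r\<le>k. p r j * l (k - r)) * L"
  proof -
    have "(\<Sum>q<n. c q * (if q = j then L else 0)) = c j * L" for c :: "nat \<Rightarrow> real"
      using Suc.prems by (subst sum.remove[of _ j]) auto
    then show ?thesis unfolding right_diff_distrib sum_subtractf by (simp only:)
  qed
  also have "(\<Sum>q<n. (\<Sum>r\<le>k. p r q * l (k - r)) * P $$ (q, j))
      = (\<Sum>r\<le>k. (\<Sum>q<n. p r q * P $$ (q, j)) * l (k - r))"
    unfolding sum_distrib_right by (subst sum.swap) (simp add: mult_ac)
  also have "\<dots> = (\<Sum>r\<le>k. real (Suc r) * p (Suc r) j * l (Suc k - Suc r))"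
    by (simp add: PS)
  also have "\<dots> = (\<Sum>r\<le>Suc k. real r * p r j * l (Suc k - r))"
    by (subst sum.atMost_Suc_shift) simp
  also have "(\<Sum>r\<le>k. p r j * l (k - r)) * L = - (\<Sum>r\<le>k. p r j * (- L * l (k - r)))"
    by (simp add: sum_distrib_left sum_negf mult_ac)
  also have "(\<Sum>r\<le>k. p r j * (- L * l (k - r))) = (\<Sum>r\<le>k. p r j * (real (Suc k - r) * l (Suc k - r)))"
    unfolding lS by (intro sum.cong) (auto simp: Suc_diff_le)
  also have "\<dots> = (\<Sum>r\<le>Suc k. p r j * (real (Suc k - r) * l (Suc k - r)))" by simp
  also have "(\<Sum>r\<le>Suc k. real r * p r j * l (Suc k - r)) - - \<dots>
      = (\<Sum>r\<le>Suc k. real (Suc k) * (p r j * l (Suc k - r)))"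
    unfolding diff_minus_eq_add sum.distrib[symmetric]
    by (intro sum.cong refl) (auto simp: of_nat_diff algebra_simps simp del: of_nat_Suc)
  finally have "real (Suc k) * ((A ^\<^sub>m Suc k) $$ (i, j) / fact (Suc k))
      = real (Suc k) * (\<Sum>r\<le>Suc k. p r j * l (Suc k - r))"
    unfolding sum_distrib_left by (simp del: of_nat_Suc pow_mat.simps sum.atMost_Suc)
  then have "(A ^\<^sub>m Suc k) $$ (i, j) / fact (Suc k) = (\<Sum>r\<le>Suc k. p r j * l (Suc k - r))"
    by (simp only: mult_left_cancel of_nat_eq_0_iff nat.distinct not_False_eq_True)
  then show ?case unfolding p_def l_def .
qed

text \<open>The law \<open>e\<^bsup>P - L I\<^esup> = e\<^bsup>-L\<^esup> e\<^bsup>P\<^esup>\<close>, obtained for each entry separately from the product of two scalar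
  series.\<close>

lemma mat_exp_shift:
  fixes A :: "real mat"
  assumes A: "A \<in> carrier_mat n n" and ij: "i < n" "j < n" and P: "P = A + L \<cdot>\<^sub>m 1\<^sub>m n"
    and summ: "summable (\<lambda>k. \<bar>(P ^\<^sub>m k) $$ (i, j)\<bar> / fact k)"
  shows "mat_exp A $$ (i, j) = exp (- L) * (\<Sum>k. (P ^\<^sub>m k) $$ (i, j) / fact k)"
proof -
  have "(\<Sum>k. (P ^\<^sub>m k) $$ (i, j) / fact k) * (\<Sum>k. (- L) ^ k / fact k)
      = (\<Sum>k. \<Sum>r\<le>k. ((P ^\<^sub>m r) $$ (i, j) / fact r) * ((- L) ^ (k - r) / fact (k - r)))"
    using summ summable_norm_exp[of "- L"]
    by (intro Cauchy_product) (auto simp: divide_inverse mult.commute abs_mult power_abs)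
  also have "\<dots> = (\<Sum>k. (A ^\<^sub>m k) $$ (i, j) / fact k)"
    unfolding P pow_mat_shift[OF A ij, of _ L] ..
  finally show ?thesis
    using A ij by (simp add: mat_exp_def exp_def divide_inverse mult.commute)
qed

text \<open>The shifted matrix has powers of norm at most \<open>L\<^sup>k\<close>, hence an exponential of norm at most
  \<open>e\<^sup>L\<close>; undoing the shift costs exactly the factor \<open>e\<^bsup>-L\<^esup>\<close>.\<close>

lemma row_bound_mat_exp:
  assumes "dissipative A" and A: "A \<in> carrier_mat n n"
  shows "row_bound (mat_exp A) 1"
proof -
  obtain L where L: "L \<ge> 0" "row_bound (A + L \<cdot>\<^sub>m 1\<^sub>m n) L"
    using assms unfolding dissipative_def by auto
  define P where "P = A + L \<cdot>\<^sub>m 1\<^sub>m n"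
  have P: "P \<in> carrier_mat n n" using A by (simp add: P_def)
  have expL: "(\<lambda>k. L ^ k / fact k) sums exp L"
    using exp_converges[of L] by (simp add: field_simps)
  have row: "(\<Sum>j<n. \<bar>(P ^\<^sub>m k) $$ (i, j)\<bar>) \<le> L ^ k" if "i < n" for i k
    using row_bound_pow[OF L(2)[folded P_def] P L(1), of k] that pow_carrier_mat[OF P, of k]
    unfolding row_bound_def by (auto simp only: carrier_matD)
  have summ: "summable (\<lambda>k. \<bar>(P ^\<^sub>m k) $$ (i, j)\<bar> / fact k)" if "i < n" "j < n" for i j
  proof (rule summable_comparison_test'[OF sums_summable[OF expL], where N = 0])
    fix k
    have "\<bar>(P ^\<^sub>m k) $$ (i, j)\<bar> \<le> (\<Sum>j<n. \<bar>(P ^\<^sub>m k) $$ (i, j)\<bar>)"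
      using that by (intro member_le_sum) auto
    also have "\<dots> \<le> L ^ k" using row that by simp
    finally show "norm (\<bar>(P ^\<^sub>m k) $$ (i, j)\<bar> / fact k) \<le> L ^ k / fact k"
      by (simp add: divide_right_mono)
  qed
  have "(\<Sum>j<n. \<bar>mat_exp A $$ (i, j)\<bar>) \<le> 1" if i: "i < n" for i
  proof -
    have "(\<Sum>j<n. \<bar>mat_exp A $$ (i, j)\<bar>)
        = exp (- L) * (\<Sum>j<n. \<bar>\<Sum>k. (P ^\<^sub>m k) $$ (i, j) / fact k\<bar>)"
      unfolding sum_distrib_left
      by (intro sum.cong refl) (simp add: mat_exp_shift[OF A i _ P_def summ[OF i]] abs_mult)
    also have "(\<Sum>j<n. \<bar>\<Sum>k. (P ^\<^sub>m k) $$ (i, j) / fact k\<bar>)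
        \<le> (\<Sum>j<n. \<Sum>k. \<bar>(P ^\<^sub>m k) $$ (i, j)\<bar> / fact k)"
    proof (rule sum_mono)
      fix j assume "j \<in> {..<n}"
      then show "\<bar>\<Sum>k. (P ^\<^sub>m k) $$ (i, j) / fact k\<bar> \<le> (\<Sum>k. \<bar>(P ^\<^sub>m k) $$ (i, j)\<bar> / fact k)"
        using summable_rabs[of "\<lambda>k. (P ^\<^sub>m k) $$ (i, j) / fact k"] summ[OF i, of j] by simp
    qed
    also have "\<dots> = (\<Sum>k. \<Sum>j<n. \<bar>(P ^\<^sub>m k) $$ (i, j)\<bar> / fact k)"
      using summ[OF i] by (intro suminf_sum[symmetric]) auto
    also have "\<dots> \<le> (\<Sum>k. L ^ k / fact k)"
      using summ[OF i] row[OF i] sums_summable[OF expL]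
      by (intro suminf_le summable_sum)
        (auto simp: sum_divide_distrib[symmetric] divide_right_mono)
    also have "\<dots> = exp L" using expL by (simp add: sums_iff)
    finally show ?thesis by (simp add: exp_minus field_simps)
  qed
  then show ?thesis using A by (simp add: row_bound_def mat_exp_def)
qed

section \<open>Diagonally dominant Toeplitz matrices\<close>

text \<open>Any shift that makes the whole diagonal nonnegative turns the diagonal dominance of \<open>A\<close> into a
  bound on absolute row sums.\<close>

lemma dissipative_diag_dominant:
  assumes A: "A \<in> carrier_mat n n"
    and dom: "\<And>i. i < n \<Longrightarrow> A $$ (i, i) + (\<Sum>j\<in>{..<n} - {i}. \<bar>A $$ (i, j)\<bar>) \<le> 0"
  shows "dissipative A"
proof -
  define L where "L = (\<Sum>i<n. \<bar>A $$ (i, i)\<bar>)"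
  have L: "\<bar>A $$ (i, i)\<bar> \<le> L" if "i < n" for i
    unfolding L_def using that by (intro member_le_sum) auto
  have "(\<Sum>j<n. \<bar>(A + L \<cdot>\<^sub>m 1\<^sub>m n) $$ (i, j)\<bar>) \<le> L" if i: "i < n" for i
  proof -
    have "(\<Sum>j<n. \<bar>(A + L \<cdot>\<^sub>m 1\<^sub>m n) $$ (i, j)\<bar>)
        = \<bar>A $$ (i, i) + L\<bar> + (\<Sum>j\<in>{..<n} - {i}. \<bar>A $$ (i, j)\<bar>)"
      using i A by (subst sum.remove[of _ i]) (auto intro!: sum.cong)
    then show ?thesis using L[OF i] dom[OF i] by linarith
  qed
  moreover have "L \<ge> 0" unfolding L_def by (rule sum_nonneg) simp
  ultimately show ?thesis using A by (auto simp: dissipative_def row_bound_def)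
qed

text \<open>Here \<open>\<beta>\<close> stands for the off-diagonal entries of a symmetric Toeplitz matrix, and the hypotheses
  on \<open>f\<close> hold for its circulant and its skew-circulant part alike when these entries are nonnegative. A row of either part consists of one
  entry for each residue modulo \<open>n\<close>, up to sign, so it contains the contributions of every \<open>\<beta> k\<close>
  twice with weight one half.\<close>

lemma dissipative_toeplitz_wrap:
  fixes f :: "int \<Rightarrow> real" and \<beta> :: "nat \<Rightarrow> real"
  assumes off: "\<And>k. 0 < k \<Longrightarrow> k < n \<Longrightarrow> \<bar>f (int k)\<bar> \<le> (\<beta> k + \<beta> (n - k)) / 2"
      "\<And>k. 0 < k \<Longrightarrow> k < n \<Longrightarrow> \<bar>f (- int k)\<bar> \<le> (\<beta> k + \<beta> (n - k)) / 2"
    and diag: "f 0 + (\<Sum>k\<in>{0<..<n}. \<beta> k) \<le> 0"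
  shows "dissipative (toeplitz n f)"
proof (rule dissipative_diag_dominant[where n = n])
  show "toeplitz n f \<in> carrier_mat n n" by (simp add: toeplitz_def)
  fix i assume i: "i < n"
  define q where "q k = (\<beta> k + \<beta> (n - k)) / 2" for k
  \<comment> \<open>The residue of \<open>i - j\<close> modulo \<open>n\<close>. To the right of the diagonal the distance \<open>j - i\<close> is replaced
    by its complement, which the symmetry of \<open>q\<close> permits.\<close>
  define \<pi> where "\<pi> j = (if j < i then i - j else n - (j - i))" for j
  have bij: "bij_betw \<pi> ({..<n} - {i}) {0<..<n}"
    using i by (intro bij_betw_byWitness[where f' = "\<lambda>k. if k \<le> i then i - k else n + i - k"])
      (auto simp: \<pi>_def)
  have rev: "bij_betw (\<lambda>k. n - k) {0<..<n} {0<..<n}"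
    by (intro bij_betw_byWitness[where f' = "\<lambda>k. n - k"]) auto
  have "(\<Sum>j\<in>{..<n} - {i}. \<bar>toeplitz n f $$ (i, j)\<bar>) \<le> (\<Sum>j\<in>{..<n} - {i}. q (\<pi> j))"
  proof (rule sum_mono)
    fix j assume j: "j \<in> {..<n} - {i}"
    show "\<bar>toeplitz n f $$ (i, j)\<bar> \<le> q (\<pi> j)"
    proof (cases "j < i")
      case True
      then have "int i - int j = int (i - j)" by simp
      then show ?thesis using i j True off(1)[of "i - j"] by (simp add: toeplitz_def q_def \<pi>_def)
    next
      case False
      then have "int i - int j = - int (j - i)" using j by simp
      moreover have "0 < j - i" "j - i < n" using i j False by auto
      ultimately show ?thesis
        using i j False off(2)[of "j - i"] by (simp add: toeplitz_def q_def \<pi>_def add.commute)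
    qed
  qed
  also have "\<dots> = (\<Sum>k\<in>{0<..<n}. q k)" by (rule sum.reindex_bij_betw[OF bij])
  also have "\<dots> = (\<Sum>k\<in>{0<..<n}. \<beta> k)"
    using sum.reindex_bij_betw[OF rev, of \<beta>]
    by (simp add: q_def sum_divide_distrib[symmetric] sum.distrib)
  finally show "toeplitz n f $$ (i, i) + (\<Sum>j\<in>{..<n} - {i}. \<bar>toeplitz n f $$ (i, j)\<bar>) \<le> 0"
    using diag i by (simp add: toeplitz_def)
qed

section \<open>Signs of the coefficients\<close>

text \<open>As \<open>g_coeff \<alpha> k\<close> is \<open>(-1)\<^sup>k\<close> times the binomial coefficient of \<open>\<alpha>\<close> over \<open>k\<close>, this is the absorption
  identity; it amounts to differentiating \<open>(1 - z)\<^sup>\<alpha>\<close>.\<close>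

lemma g_coeff_lower_order:
  "g_coeff \<alpha> (Suc n) = - \<alpha> / real (Suc n) * g_coeff (\<alpha> - 1) n"
proof (induction n)
  case 0
  then show ?case by simp
next
  case (Suc n)
  show ?case
    unfolding g_coeff.simps(2)[of \<alpha> "Suc n"] Suc.IH
    by (simp add: field_simps)
qed

text \<open>Dividing \<open>(1 - z)\<^sup>\<alpha>\<close> by \<open>1 - z\<close> sums its coefficients.\<close>

lemma sum_g_coeff: "(\<Sum>k\<le>n. g_coeff \<alpha> k) = g_coeff (\<alpha> - 1) n"
proof (induction n)
  case (Suc n)
  show ?case
    unfolding sum.atMost_Suc Suc.IH g_coeff_lower_order[of \<alpha> n]
    by (simp add: field_simps)
qed simp

lemma g_coeff_nonpos:
  assumes "0 < \<beta>" "\<beta> < 1" "n \<ge> 1"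
  shows "g_coeff \<beta> n \<le> 0"
  using assms(3)
proof (induction n rule: dec_induct)
  case base
  then show ?case using assms by simp
next
  case (step n)
  have "0 \<le> 1 - (\<beta> + 1) / real (n + 1)"
    using assms step by (simp add: field_simps)
  then show ?case using step by (simp add: mult_nonneg_nonpos)
qed

lemma g_coeff_nonneg:
  assumes "1 < \<alpha>" "\<alpha> < 2" "n \<ge> 2"
  shows "g_coeff \<alpha> n \<ge> 0"
proof -
  obtain k where k: "n = Suc k" "k \<ge> 1" using assms(3) by (cases n) auto
  then show ?thesis
    unfolding k(1) g_coeff_lower_order using g_coeff_nonpos[of "\<alpha> - 1" k] assms
    by (intro mult_nonpos_nonpos) (auto simp: field_simps)
qed

lemma \<omega>_coeff_nonneg:
  assumes "1 < \<alpha>" "\<alpha> < 2" "n \<ge> 3"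
  shows "\<omega>_coeff \<alpha> n \<ge> 0"
proof -
  obtain k where k: "n = Suc k" "k \<ge> 2" using assms(3) by (cases n) auto
  then show ?thesis
    using g_coeff_nonneg[OF assms(1,2), of k] g_coeff_nonneg[OF assms(1,2), of "Suc k"] assms
    by (simp del: g_coeff.simps)
qed

text \<open>The coefficient with index 2 alone is negative for \<open>\<alpha>\<close> near 1. It enters the matrix \<open>D + D\<^sup>T\<close>
  only together with the one with index 0, since both are next to the diagonal.\<close>

lemma \<omega>_coeff_0_2_nonneg:
  assumes "1 < \<alpha>" "\<alpha> < 2"
  shows "\<omega>_coeff \<alpha> 0 + \<omega>_coeff \<alpha> 2 \<ge> 0"
proof -
  have "\<omega>_coeff \<alpha> 0 + \<omega>_coeff \<alpha> 2 = \<alpha> * (\<alpha> - 1) * (\<alpha> + 2) / 4"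
    by (simp add: eval_nat_numeral field_simps)
  moreover have "0 \<le> \<alpha> * (\<alpha> - 1) * (\<alpha> + 2) / 4" using assms by simp
  ultimately show ?thesis by simp
qed

lemma \<omega>_coeff_1_nonpos:
  assumes "1 < \<alpha>" "\<alpha> < 2"
  shows "\<omega>_coeff \<alpha> 1 \<le> 0"
proof -
  have "\<omega>_coeff \<alpha> 1 = - ((\<alpha> - 1) * (\<alpha> + 2) / 2)"
    by (simp add: field_simps)
  then show ?thesis using assms by simp
qed

lemma sum_\<omega>_coeff_nonpos:
  assumes "1 < \<alpha>" "\<alpha> < 2" "n \<ge> 2"
  shows "(\<Sum>k\<le>n. \<omega>_coeff \<alpha> k) \<le> 0"
proof -
  have eq: "(\<Sum>k\<le>Suc n. \<omega>_coeff \<alpha> k)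
      = \<alpha> / 2 * g_coeff (\<alpha> - 1) (Suc n) + (2 - \<alpha>) / 2 * g_coeff (\<alpha> - 1) n" for n
    unfolding sum_g_coeff[symmetric]
    by (induction n) (simp_all add: algebra_simps del: g_coeff.simps)
  obtain k where k: "n = Suc k" "k \<ge> 1" using assms(3) by (cases n) auto
  show ?thesis
    unfolding k(1) eq using g_coeff_nonpos[of "\<alpha> - 1" k] g_coeff_nonpos[of "\<alpha> - 1" "Suc k"] assms k
    by (intro add_nonpos_nonpos mult_nonneg_nonpos) (auto simp del: g_coeff.simps)
qed

section \<open>The one-dimensional circulant and skew-circulant parts\<close>

text \<open>The entries of \<open>D + D\<^sup>T\<close> at distance \<open>k\<close> from the diagonal. Both matrices
  contribute on the diagonal and next to it, and only one of them further away.\<close>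

definition B_coeff :: "real \<Rightarrow> nat \<Rightarrow> real" where
  "B_coeff \<alpha> k = \<omega>_coeff \<alpha> (k + 1) + (if k \<le> 1 then \<omega>_coeff \<alpha> (1 - k) else 0)"

lemma B_coeff_nonneg:
  assumes "1 < \<alpha>" "\<alpha> < 2" "k \<ge> 1"
  shows "B_coeff \<alpha> k \<ge> 0"
proof (cases "k = 1")
  case True
  then show ?thesis using \<omega>_coeff_0_2_nonneg[OF assms(1,2)]
    by (simp add: B_coeff_def numeral_2_eq_2 del: \<omega>_coeff.simps)
next
  case False
  then show ?thesis using assms \<omega>_coeff_nonneg[OF assms(1,2), of "k + 1"]
    by (simp add: B_coeff_def del: \<omega>_coeff.simps)
qed

text \<open>Halving the diagonal leaves \<open>\<omega>\<^sub>1\<close>, and the off-diagonal entries supply every other coefficient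
  exactly once. For \<open>n \<ge> 2\<close> the sum is therefore a partial sum of \<open>\<omega>\<close>; for smaller \<open>n\<close> only
  \<open>\<omega>\<^sub>1\<close> remains.\<close>

lemma B_coeff_sum_nonpos:
  assumes "1 < \<alpha>" "\<alpha> < 2"
  shows "B_coeff \<alpha> 0 / 2 + (\<Sum>k\<in>{0<..<n}. B_coeff \<alpha> k) \<le> 0"
proof (cases "n \<le> 1")
  case True
  then have "{0<..<n} = {}" by auto
  then show ?thesis using \<omega>_coeff_1_nonpos[OF assms] by (simp add: B_coeff_def)
next
  case False
  have *: "B_coeff \<alpha> 0 / 2 + (\<Sum>k\<in>{0<..<Suc (Suc r)}. B_coeff \<alpha> k)
      = (\<Sum>k\<le>Suc (Suc r). \<omega>_coeff \<alpha> k)" for r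
  proof (induction r)
    case 0
    have "{0<..<Suc (Suc 0)} = {1}" by auto
    then show ?case by (simp add: B_coeff_def del: \<omega>_coeff.simps)
  next
    case (Suc r)
    have "{0<..<Suc (Suc (Suc r))} = insert (Suc (Suc r)) {0<..<Suc (Suc r)}" by auto
    then show ?case using Suc by (simp add: B_coeff_def del: \<omega>_coeff.simps)
  qed
  have "n = Suc (Suc (n - 2))" using False by simp
  then obtain r where "n = Suc (Suc r)" ..
  then show ?thesis using *[of r] sum_\<omega>_coeff_nonpos[OF assms, of n] by (simp only:)
qed

text \<open>The argument of the cosine lies in the second quadrant.\<close>

lemma B_scale_nonneg:
  assumes "1 < \<alpha>" "\<alpha> < 2"
  shows "0 \<le> - (\<epsilon>\<^sup>2 / (2 * h powr \<alpha> * cos (\<alpha> * pi / 2)))"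
proof -
  have "0 < cos (pi - \<alpha> * pi / 2)"
    using assms pi_gt_zero by (intro cos_gt_zero_pi) (auto simp: field_simps)
  then have "cos (\<alpha> * pi / 2) \<le> 0" by simp
  then have "\<epsilon>\<^sup>2 / (2 * h powr \<alpha> * cos (\<alpha> * pi / 2)) \<le> 0"
    by (intro divide_nonneg_nonpos mult_nonneg_nonpos) auto
  then show ?thesis by simp
qed

lemma diag_entry_B_mat:
  fixes \<epsilon> \<alpha> h :: real
  assumes "k < m - 1"
  defines "K \<equiv> - (\<epsilon>\<^sup>2 / (2 * h powr \<alpha> * cos (\<alpha> * pi / 2)))"
  shows "diag_entry (B_mat \<epsilon> \<alpha> m h) (int k) = K * B_coeff \<alpha> k"
    and "diag_entry (B_mat \<epsilon> \<alpha> m h) (- int k) = K * B_coeff \<alpha> k"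
  using assms(1)
  by (auto simp: diag_entry_def B_mat_def D_mat_def B_coeff_def K_def simp del: \<omega>_coeff.simps)

lemma C_mat_carrier: "C_mat \<epsilon> \<alpha> m h \<in> carrier_mat (m - 1) (m - 1)"
  by (rule carrier_matI) (rule C_mat_dim)+

lemma S_mat_carrier: "S_mat \<epsilon> \<alpha> m h \<in> carrier_mat (m - 1) (m - 1)"
  by (rule carrier_matI) (rule S_mat_dim)+

lemma dissipative_C_S_mat:
  assumes "1 < \<alpha>" "\<alpha> < 2" "m \<ge> 2"
  shows "dissipative (C_mat \<epsilon> \<alpha> m h)" "dissipative (S_mat \<epsilon> \<alpha> m h)"
proof -
  define K where "K = - (\<epsilon>\<^sup>2 / (2 * h powr \<alpha> * cos (\<alpha> * pi / 2)))"
  define n where "n = m - 1"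
  define b where "b = diag_entry (B_mat \<epsilon> \<alpha> m h)"
  define \<beta> where "\<beta> k = K * B_coeff \<alpha> k" for k
  have K: "K \<ge> 0" unfolding K_def by (rule B_scale_nonneg[OF assms(1,2)])
  have b: "b (int k) = \<beta> k" "b (- int k) = \<beta> k" if "k < n" for k
    using diag_entry_B_mat[of k m] that by (simp_all add: b_def n_def \<beta>_def K_def)
  have b0: "b 0 = \<beta> 0" using b(1)[of 0] assms by (simp add: n_def)
  have \<beta>0: "\<beta> k \<ge> 0" if "0 < k" for k
    unfolding \<beta>_def using K B_coeff_nonneg[OF assms(1,2), of k] that by simp
  have wrap: "b (int k - int m + 1) = \<beta> (n - k)" "b (int m - int k - 1) = \<beta> (n - k)"
    if "0 < k" "k < n" for k
  proof -
    have "int k - int m + 1 = - int (n - k)" "int m - int k - 1 = int (n - k)"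
      using that by (auto simp: n_def)
    then show "b (int k - int m + 1) = \<beta> (n - k)" "b (int m - int k - 1) = \<beta> (n - k)"
      using b[of "n - k"] that by (simp_all only:)
  qed
  have diag: "b 0 / 2 + (\<Sum>k\<in>{0<..<n}. \<beta> k) \<le> 0"
    using mult_nonneg_nonpos[OF K B_coeff_sum_nonpos[OF assms(1,2), of n]]
    by (simp add: b0 \<beta>_def sum_distrib_left distrib_left)
  \<comment> \<open>The skew-circulant part differs only by a sign, which the triangle inequality absorbs.\<close>
  have tri: "\<bar>(\<beta> k + \<beta> (n - k)) / 2\<bar> \<le> (\<beta> k + \<beta> (n - k)) / 2"
    "\<bar>(\<beta> k - \<beta> (n - k)) / 2\<bar> \<le> (\<beta> k + \<beta> (n - k)) / 2" if "0 < k" "k < n" for k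
    using \<beta>0[of k] \<beta>0[of "n - k"] that by (auto simp: abs_if field_simps)
  show "dissipative (C_mat \<epsilon> \<alpha> m h)"
    unfolding C_mat_def b_def[symmetric] n_def[symmetric]
    by (rule dissipative_toeplitz_wrap[where \<beta> = \<beta>])
      (use diag tri in \<open>auto simp: circ_coeff_def b wrap\<close>)
  show "dissipative (S_mat \<epsilon> \<alpha> m h)"
    unfolding S_mat_def b_def[symmetric] n_def[symmetric]
    by (rule dissipative_toeplitz_wrap[where \<beta> = \<beta>])
      (use diag tri in \<open>auto simp: skew_coeff_def b wrap\<close>)
qed

section \<open>The splitting method\<close>

lemma max_norm_le_iff:
  assumes "v \<in> carrier_vec n" "n > 0"
  shows "max_norm v \<le> c \<longleftrightarrow> (\<forall>i<n. \<bar>v $ i\<bar> \<le> c)"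
proof -
  have "(\<lambda>i. \<bar>v $ i\<bar>) ` {..<n} \<noteq> {}" using assms(2) by auto
  then show ?thesis using assms(1) by (auto simp: max_norm_def)
qed

lemma max_norm_mult_vec_le:
  assumes "row_bound A 1" "A \<in> carrier_mat n n" "v \<in> carrier_vec n" "n > 0" "max_norm v \<le> 1"
  shows "max_norm (A *\<^sub>v v) \<le> 1"
  using assms row_bound_mult_vec[OF assms(1-3)]
  by (subst max_norm_le_iff[where n = n]) (auto simp: max_norm_le_iff)

text \<open>For \<open>x\<^sup>2 \<le> 1\<close> the term added to \<open>x\<^sup>2\<close> under the root is nonnegative, so the denominator is at
  least \<open>\<bar>x\<bar>\<close>.\<close>

lemma max_norm_J_Q_le:
  assumes "v \<in> carrier_vec n" "n > 0" "max_norm v \<le> 1"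
  shows "max_norm (J_Q \<tau> v) \<le> 1"
proof -
  have *: "\<bar>x / sqrt (x\<^sup>2 + (1 - x\<^sup>2) * exp (- 2 * \<tau>))\<bar> \<le> 1" if "\<bar>x\<bar> \<le> 1" for x :: real
  proof -
    have "x\<^sup>2 \<le> 1" using that by (simp add: abs_square_le_1)
    then have "\<bar>x\<bar> \<le> sqrt (x\<^sup>2 + (1 - x\<^sup>2) * exp (- 2 * \<tau>))"
      by (intro real_le_rsqrt) simp
    then show ?thesis by (auto simp: divide_le_eq_1)
  qed
  have "\<forall>i<n. \<bar>J_Q \<tau> v $ i\<bar> \<le> 1"
    using assms * by (auto simp: max_norm_le_iff J_Q_def)
  then show ?thesis using assms by (subst max_norm_le_iff[where n = n]) (auto simp: J_Q_def)
qed

lemma strang_step_max_norm: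
  assumes C: "C \<in> carrier_mat n n" "dissipative C" and S: "S \<in> carrier_mat n n" "dissipative S"
    and v: "v \<in> carrier_vec n" "max_norm v \<le> 1" and "n > 0" "\<tau> \<ge> 0"
  shows "strang_step C S \<tau> v \<in> carrier_vec n" "max_norm (strang_step C S \<tau> v) \<le> 1"
proof -
  define E where "E = mat_exp ((\<tau> / 2) \<cdot>\<^sub>m C)"
  define F where "F = mat_exp (\<tau> \<cdot>\<^sub>m S)"
  have E: "E \<in> carrier_mat n n" "row_bound E 1"
    using C assms(8) row_bound_mat_exp[of "(\<tau> / 2) \<cdot>\<^sub>m C" n] dissipative_smult[of C n "\<tau> / 2"]
    by (auto simp: E_def mat_exp_def)
  have F: "F \<in> carrier_mat n n" "row_bound F 1"
    using S assms(8) row_bound_mat_exp[of "\<tau> \<cdot>\<^sub>m S" n] dissipative_smult[of S n \<tau>]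
    by (auto simp: F_def mat_exp_def)
  have M: "E * F * E \<in> carrier_mat n n" using E F by simp
  have "row_bound (E * F) 1" using row_bound_mult[OF E(2) F(2) E(1) F(1)] by simp
  then have "row_bound (E * F * E) 1"
    using row_bound_mult[of "E * F" 1 E 1 n n n] E F by simp
  then have P: "max_norm ((E * F * E) *\<^sub>v w) \<le> 1" if "w \<in> carrier_vec n" "max_norm w \<le> 1" for w
    using max_norm_mult_vec_le M that assms(7) by blast
  have Q: "J_Q t w \<in> carrier_vec n" if "w \<in> carrier_vec n" for w t
    using that by (simp add: J_Q_def)
  show "strang_step C S \<tau> v \<in> carrier_vec n"
    using M Q v by (auto simp: strang_step_def J_P_def E_def[symmetric] F_def[symmetric])
  show "max_norm (strang_step C S \<tau> v) \<le> 1"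
    unfolding strang_step_def J_P_def E_def[symmetric] F_def[symmetric]
    using v Q M assms(7)
    by (intro max_norm_J_Q_le[where n = n] P) (auto intro: max_norm_J_Q_le)
qed

theorem theorem1:
  fixes d :: nat and \<epsilon> a b \<tau> :: real
    and \<alpha> h :: "nat \<Rightarrow> real" and m :: "nat \<Rightarrow> nat"
    and u0 :: "real vec" and u :: "nat \<Rightarrow> real vec"
  assumes "d \<in> {2, 3}"
    and "\<epsilon> > 0"
    and "a < b"
    and "\<forall>l\<in>{1..d}. 1 < \<alpha> l \<and> \<alpha> l < 2"
    and "\<forall>l\<in>{1..d}. m l \<ge> 2"
    and "\<forall>l\<in>{1..d}. h l = (b - a) / real (m l)"
    and "u0 \<in> carrier_vec (\<Prod>l=1..d. (m l - 1))"
    and "max_norm u0 \<le> 1"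
    and "\<tau> > 0"
    and "u 0 = u0"
    and "\<forall>n. u (Suc n) = strang_step (C_full d \<epsilon> \<alpha> m h) (S_full d \<epsilon> \<alpha> m h) \<tau> (u n)"
  shows "\<forall>n. max_norm (u n) \<le> 1"
proof -
  define N where "N = (\<Prod>l=1..d. (m l - 1))"
  have N: "N > 0" unfolding N_def
  proof (rule prod_pos)
    fix l assume "l \<in> {1..d}"
    then have "m l \<ge> 2" using assms(5) by blast
    then show "0 < m l - 1" by simp
  qed
  have one_dim: "dissipative (C_mat \<epsilon> (\<alpha> l) (m l) (h l))"
    "dissipative (S_mat \<epsilon> (\<alpha> l) (m l) (h l))" if "l \<in> {1..d}" for l
    using dissipative_C_S_mat[of "\<alpha> l" "m l"] assms(4,5) that by blast+
  have C: "C_full d \<epsilon> \<alpha> m h \<in> carrier_mat N N"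
    unfolding C_full_def N_def by (rule kron_sum_carrier[OF assms(1)]) (rule C_mat_carrier S_mat_carrier)
  have C': "dissipative (C_full d \<epsilon> \<alpha> m h)"
    unfolding C_full_def
    by (rule dissipative_kron_sum[OF assms(1)]) (rule C_mat_carrier S_mat_carrier one_dim, assumption?)+
  have S: "S_full d \<epsilon> \<alpha> m h \<in> carrier_mat N N"
    unfolding S_full_def N_def by (rule kron_sum_carrier[OF assms(1)]) (rule C_mat_carrier S_mat_carrier)
  have S': "dissipative (S_full d \<epsilon> \<alpha> m h)"
    unfolding S_full_def
    by (rule dissipative_kron_sum[OF assms(1)]) (rule C_mat_carrier S_mat_carrier one_dim, assumption?)+
  have "u n \<in> carrier_vec N \<and> max_norm (u n) \<le> 1" for n
  proof (induction n)
    case 0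
    show ?case unfolding N_def \<open>u 0 = u0\<close> using assms(7,8) by (rule conjI)
  next
    case (Suc n)
    have "u (Suc n) = strang_step (C_full d \<epsilon> \<alpha> m h) (S_full d \<epsilon> \<alpha> m h) \<tau> (u n)"
      using assms(11) by blast
    then show ?case
      using strang_step_max_norm[OF C C' S S' _ _ N less_imp_le[OF \<open>\<tau> > 0\<close>]] Suc.IH
      by (simp only: simp_thms)
  qed
  then show ?thesis by blast
qed

end
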